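(* Let $n$ be a positive integer and let $a_1,a_2,\ldots,a_n$ be any integers. Then the number $$\sum_{k=1}^{n}\frac{n}{k}\sum_{\substack{\lambda_1+\lambda_2+\cdots+\lambda_k=n\\ \lambda_i>0}} a_{\lambda_1}a_{\lambda_2}\cdots a_{\lambda_k}$$ is an integer, where the inner sum runs over all ordered $k$-tuples $(\lambda_1,\ldots,\lambda_k)$ of positive integers with $\lambda_1+\cdots+\lambda_k=n$. *)

theory Defs
  imports Complex_Main
begin

definition compositions :: "nat \<Rightarrow> nat \<Rightarrow> nat list set" where
  "compositions n k = {ls. length ls = k \<and> (\<forall>l\<in>set ls. 0 < l) \<and> sum_list ls = n}"

text \<open>A sum over an infinite set would be 0 by convention; this does not happen here.\<close>

lemma finite_compositions: "finite (compositions n k)"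
proof (rule finite_subset)
  show "compositions n k \<subseteq> {ls. set ls \<subseteq> {..n} \<and> length ls = k}"
    using member_le_sum_list by (force simp: compositions_def)
  show "finite {ls. set ls \<subseteq> {..n} \<and> length ls = k}"
    by (rule finite_lists_length_eq) simp
qed

end

theory Submission
  imports Defs
begin

text \<open>
  Each summand is already an integer. The compositions of \<open>n\<close> into \<open>k\<close> parts are permuted by rotation,
  which preserves the weight \<open>a\<^sub>\<lambda>\<^sub>1 \<cdots> a\<^sub>\<lambda>\<^sub>k\<close>. Writing \<open>n\<close> as the sum of the parts,
  every part therefore contributes as much as the first one, so the factor \<open>n / k\<close> amounts to
  weighting each composition by its first part.
\<close>

lemma prod_list_rotate:
  fixes xs :: "'a::comm_monoid_mult list"
  shows "prod_list (rotate i xs) = prod_list xs"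
proof (induction i)
  case (Suc i)
  have "prod_list (rotate1 ys) = prod_list ys" for ys :: "'a list"
    by (cases ys) (simp_all add: mult.commute)
  with Suc show ?case
    by simp
qed simp

lemma sum_list_rotate:
  fixes xs :: "'a::comm_monoid_add list"
  shows "sum_list (rotate i xs) = sum_list xs"
proof (induction i)
  case (Suc i)
  have "sum_list (rotate1 ys) = sum_list ys" for ys :: "'a list"
    by (cases ys) (simp_all add: add.commute)
  with Suc show ?case
    by simp
qed simp

lemma rotate_in_compositions: "ls \<in> compositions n k \<Longrightarrow> rotate i ls \<in> compositions n k"
  by (simp add: compositions_def sum_list_rotate)

text \<open>\<open>rotate i\<close> iterates the injective map \<open>rotate1\<close>, and an
  injective self-map of a finite set is onto.\<close>

lemma bij_betw_rotate_compositions: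
  "bij_betw (rotate i) (compositions n k) (compositions n k)"
proof -
  have inj: "inj_on (rotate i) (compositions n k)"
    unfolding rotate_def by (rule inj_on_subset [OF inj_fn [OF inj_rotate1]]) simp
  moreover have "rotate i ` compositions n k = compositions n k"
    using finite_compositions rotate_in_compositions inj
    by (intro endo_inj_surj) auto
  ultimately show ?thesis
    by (simp add: bij_betw_def)
qed

text \<open>Multiplying by \<open>k\<close> instead of dividing keeps the identity meaningful in any
  commutative semiring, in particular over \<open>int\<close>. For \<open>k = 0\<close> both sides
  vanish, whatever value \<open>hd []\<close> has.\<close>

lemma sum_compositions_first_part:
  fixes f :: "nat \<Rightarrow> 'a::comm_semiring_1"
  shows "of_nat n * (\<Sum>ls\<in>compositions n k. prod_list (map f ls)) =
         of_nat k * (\<Sum>ls\<in>compositions n k. of_nat (hd ls) * prod_list (map f ls))"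
proof -
  let ?w = "\<lambda>ls. prod_list (map f ls)"
  have "of_nat n * (\<Sum>ls\<in>compositions n k. ?w ls) =
        (\<Sum>ls\<in>compositions n k. \<Sum>i<k. of_nat (ls ! i) * ?w ls)"
    unfolding sum_distrib_left
    by (intro sum.cong refl)
       (auto simp: compositions_def sum_list_sum_nth atLeast0LessThan sum_distrib_right)
  also have "\<dots> = (\<Sum>i<k. \<Sum>ls\<in>compositions n k. of_nat (ls ! i) * ?w ls)"
    by (rule sum.swap)
  also have "\<dots> = (\<Sum>i<k. \<Sum>ls\<in>compositions n k. of_nat (hd ls) * ?w ls)"
  proof (rule sum.cong [OF refl])
    fix i assume "i \<in> {..<k}"
    have "hd (rotate i ls) = ls ! i" if "ls \<in> compositions n k" for ls
    proof -
      have "i < length ls"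
        using that \<open>i \<in> {..<k}\<close> by (simp add: compositions_def)
      then show ?thesis
        by (subst hd_rotate_conv_nth) auto
    qed
    \<comment> \<open>The whole summand becomes a function of \<open>rotate i ls\<close>: the part
      \<open>ls ! i\<close> is its head, and the weight is unchanged by rotation. Reindexing along
      the bijection \<open>rotate i\<close> then removes the rotation.\<close>
    then have "(\<Sum>ls\<in>compositions n k. of_nat (ls ! i) * ?w ls) =
               (\<Sum>ls\<in>compositions n k. of_nat (hd (rotate i ls)) * ?w (rotate i ls))"
      by (simp add: prod_list_rotate flip: rotate_map)
    also have "\<dots> = (\<Sum>ls\<in>compositions n k. of_nat (hd ls) * ?w ls)"
      by (rule sum.reindex_bij_betw [OF bij_betw_rotate_compositions])
    finally show "(\<Sum>ls\<in>compositions n k. of_nat (ls ! i) * ?w ls) =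
                  (\<Sum>ls\<in>compositions n k. of_nat (hd ls) * ?w ls)" .
  qed
  finally show ?thesis
    by simp
qed

theorem theorem2:
  fixes n :: nat and a :: "nat \<Rightarrow> int"
  assumes "n > 0"
  shows "(\<Sum>k=1..n. (of_nat n / of_nat k :: rat) *
           (\<Sum>ls\<in>compositions n k. of_int (prod_list (map a ls)))) \<in> \<int>"
proof (rule Ints_sum)
  fix k assume "k \<in> {1..n}"
  then have "k > 0"
    by simp
  \<comment> \<open>The identity is taken over \<open>int\<close>, where \<open>a\<close> lives, and
    carried to \<open>rat\<close> by \<open>of_int\<close>; only there is it divided by
    \<open>k\<close>.\<close>
  have "of_nat n * (\<Sum>ls\<in>compositions n k. of_int (prod_list (map a ls))) =
        (of_nat k * (\<Sum>ls\<in>compositions n k. of_nat (hd ls) * of_int (prod_list (map a ls))) :: rat)"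
    using arg_cong [OF sum_compositions_first_part [where n = n and k = k and f = a], of "of_int :: int \<Rightarrow> rat"]
    by simp
  with \<open>k > 0\<close>
  have "(of_nat n / of_nat k) * (\<Sum>ls\<in>compositions n k. of_int (prod_list (map a ls))) =
        ((\<Sum>ls\<in>compositions n k. of_nat (hd ls) * of_int (prod_list (map a ls))) :: rat)"
    by (simp add: field_simps)
  also have "\<dots> \<in> \<int>"
    by (intro Ints_sum Ints_mult) auto
  finally show "(of_nat n / of_nat k :: rat) *
                (\<Sum>ls\<in>compositions n k. of_int (prod_list (map a ls))) \<in> \<int>" .
qed

end
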